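(* Let $x\in X$ and $y\in Y$ be states in finitely branching $F$-coalgebras $(X,\xi)$ and $(Y,\zeta)$, and let $\epsilon\in\mathcal V$. Then $d_\Lambda(x,y)\le\epsilon$ if and only if $x$ is logically included in $y$ up to $\epsilon$.
   Context: Let $\mathcal V=[0,1]$, and let $q\ominus\epsilon=\max(q-\epsilon,0)$. Let $F\colon\mathbf{Set}\to\mathbf{Set}$ be a functor. An $F$-coalgebra $(X,\xi)$ is a set $X$ with a map $\xi\colon X\to FX$. It is finitely branching if for every $x\in X$ there are a finite $X_0\subseteq X$ and $a\in FX_0$ with $Fi(a)=\xi(x)$, where $i\colon X_0\hookrightarrow X$ is the inclusion. A monotone $2$-to-$\mathcal V$ predicate lifting $\lambda$ is a family $\lambda_X\colon 2^X\to\mathcal V^{FX}$ (subsets identified with $2$-valued predicates) that is natural, i.e. $\lambda_Y(A)(Ff(a))=\lambda_X(f^{-1}[A])(a)$, and monotone in $A$. Fix a set $\Lambda$ of such liftings. A relation $R\subseteq X\times Y$ is an $\epsilon$-$\Lambda$-simulation if whenever $xRy$, then $\lambda_Y(R[A])(\zeta(y))\ge\lambda_X(A)(\xi(x))-\epsilon$ for all $\lambda\in\Lambda$ and $A\subseteq X$, where $R[A]=\{y\mid\exists x\in A.\ xRy\}$. Write $x\preceq_{\epsilon,\Lambda}y$ if some such $R$ relates $x,y$, and put $d_\Lambda(x,y)=\bigwedge\{\epsilon\in\mathcal V\mid x\preceq_{\epsilon,\Lambda}y\}$. Formulae are given by $$\phi,\psi::=\bot\mid\top\mid\phi\wedge\psi\mid\phi\vee\psi\mid\lambda_q\phi\qquad(\lambda\in\Lambda,\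 q\in\mathcal V).$$ For a state $x$ of a coalgebra $(X,\xi)$ and $\epsilon\in\mathcal V$, satisfaction up to $\epsilon$ is defined as follows: - $x\models_\epsilon\top$, and $x\not\models_\epsilon\bot$; - conjunction and disjunction are interpreted as usual; - $x\models_\epsilon\lambda_q\phi$ iff $\lambda_X([\![\phi]\!]_\epsilon)(\xi(x))\ge q\ominus\epsilon$, where $[\![\phi]\!]_\epsilon=\{z\in X\mid z\models_\epsilon\phi\}$. We say $x$ is logically included in $y$ up to $\epsilon$ if for all formulae $\phi$ and all $\delta\in\mathcal V$, $x\models_\delta\phi$ implies $y\models_{\delta+\epsilon}\phi$. *)

theory Defs
  imports Complex_Main "HOL-Library.FuncSet"
begin

abbreviation V :: "real set" where
  "V \<equiv> {0..1}"

definition tminus :: "real \<Rightarrow> real \<Rightarrow> real" (infixl "\<ominus>" 65) where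
  "q \<ominus> \<epsilon> = max (q - \<epsilon>) 0"

text \<open>Addition of error bounds stays inside \<open>V\<close>, so it is truncated at 1.\<close>

definition tplus :: "real \<Rightarrow> real \<Rightarrow> real" (infixl "\<oplus>" 65) where
  "\<delta> \<oplus> \<epsilon> = min (\<delta> + \<epsilon>) 1"

text \<open>HOL cannot quantify over type constructors, so the category of sets is represented by all
  subsets of an arbitrary universe type \<open>'u\<close>, with the extensional function spaces
  \<open>X \<rightarrow>\<^sub>E Y\<close> as hom-sets. A functor \<open>(F, Fm)\<close> sends an object
  \<open>X\<close> to a set \<open>F X\<close> over a second universe \<open>'f\<close>, and a morphism
  \<open>f\<close> from \<open>X\<close> to \<open>Y\<close> to \<open>Fm X Y f\<close>. As \<open>'u\<close> and
  \<open>'f\<close> are type variables, they can be taken large enough for any given pair of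
  coalgebras.\<close>

definition set_functor ::
  "('u set \<Rightarrow> 'f set) \<Rightarrow> ('u set \<Rightarrow> 'u set \<Rightarrow> ('u \<Rightarrow> 'u) \<Rightarrow> 'f \<Rightarrow> 'f) \<Rightarrow> bool" where
  "set_functor F Fm \<longleftrightarrow>
     (\<forall>X Y. \<forall>f \<in> X \<rightarrow>\<^sub>E Y. Fm X Y f \<in> F X \<rightarrow>\<^sub>E F Y) \<and>
     (\<forall>X. Fm X X (\<lambda>x\<in>X. x) = (\<lambda>a\<in>F X. a)) \<and>
     (\<forall>X Y Z. \<forall>f \<in> X \<rightarrow>\<^sub>E Y. \<forall>g \<in> Y \<rightarrow>\<^sub>E Z.
        Fm X Z (compose X g f) = compose (F X) (Fm Y Z g) (Fm X Y f))"

definition coalgebra :: "('u set \<Rightarrow> 'f set) \<Rightarrow> 'u set \<Rightarrow> ('u \<Rightarrow> 'f) \<Rightarrow> bool" where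
  "coalgebra F X \<xi> \<longleftrightarrow> \<xi> \<in> X \<rightarrow> F X"

definition finitely_branching ::
  "('u set \<Rightarrow> 'f set) \<Rightarrow> ('u set \<Rightarrow> 'u set \<Rightarrow> ('u \<Rightarrow> 'u) \<Rightarrow> 'f \<Rightarrow> 'f) \<Rightarrow>
   'u set \<Rightarrow> ('u \<Rightarrow> 'f) \<Rightarrow> bool" where
  "finitely_branching F Fm X \<xi> \<longleftrightarrow>
     (\<forall>x\<in>X. \<exists>X0. X0 \<subseteq> X \<and> finite X0 \<and> (\<exists>a\<in>F X0. Fm X0 X (\<lambda>z\<in>X0. z) a = \<xi> x))"

text \<open>For a lifting \<open>l\<close>, the value \<open>l X A a\<close> is only meaningful for
  \<open>A \<subseteq> X\<close> and \<open>a \<in> F X\<close>.\<close>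

type_synonym ('u, 'f) lifting = "'u set \<Rightarrow> 'u set \<Rightarrow> 'f \<Rightarrow> real"

definition monotone_predicate_lifting ::
  "('u set \<Rightarrow> 'f set) \<Rightarrow> ('u set \<Rightarrow> 'u set \<Rightarrow> ('u \<Rightarrow> 'u) \<Rightarrow> 'f \<Rightarrow> 'f) \<Rightarrow>
   ('u, 'f) lifting \<Rightarrow> bool" where
  "monotone_predicate_lifting F Fm l \<longleftrightarrow>
     (\<forall>X A. A \<subseteq> X \<longrightarrow> (\<forall>a\<in>F X. l X A a \<in> V)) \<and>
     (\<forall>X Y. \<forall>f \<in> X \<rightarrow>\<^sub>E Y. \<forall>A. A \<subseteq> Y \<longrightarrow>
        (\<forall>a\<in>F X. l Y A (Fm X Y f a) = l X {x\<in>X. f x \<in> A} a)) \<and>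
     (\<forall>X A B. A \<subseteq> B \<longrightarrow> B \<subseteq> X \<longrightarrow> (\<forall>a\<in>F X. l X A a \<le> l X B a))"

definition simulation ::
  "('u, 'f) lifting set \<Rightarrow> real \<Rightarrow> 'u set \<Rightarrow> ('u \<Rightarrow> 'f) \<Rightarrow> 'u set \<Rightarrow> ('u \<Rightarrow> 'f) \<Rightarrow>
   ('u \<times> 'u) set \<Rightarrow> bool" where
  "simulation \<Lambda> \<epsilon> X \<xi> Y \<zeta> R \<longleftrightarrow> R \<subseteq> X \<times> Y \<and>
     (\<forall>(x, y)\<in>R. \<forall>l\<in>\<Lambda>. \<forall>A. A \<subseteq> X \<longrightarrow> l Y (R `` A) (\<zeta> y) \<ge> l X A (\<xi> x) - \<epsilon>)"

definition similar ::
  "('u, 'f) lifting set \<Rightarrow> real \<Rightarrow> 'u set \<Rightarrow> ('u \<Rightarrow> 'f) \<Rightarrow> 'u set \<Rightarrow> ('u \<Rightarrow> 'f) \<Rightarrow>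
   'u \<Rightarrow> 'u \<Rightarrow> bool" where
  "similar \<Lambda> \<epsilon> X \<xi> Y \<zeta> x y \<longleftrightarrow> (\<exists>R. simulation \<Lambda> \<epsilon> X \<xi> Y \<zeta> R \<and> (x, y) \<in> R)"

text \<open>For states \<open>x \<in> X\<close> and \<open>y \<in> Y\<close> the set below contains 1, witnessed by
  the full relation \<open>X \<times> Y\<close>, so this infimum of reals agrees with the one taken
  in \<open>V\<close>.\<close>

definition sim_dist ::
  "('u, 'f) lifting set \<Rightarrow> 'u set \<Rightarrow> ('u \<Rightarrow> 'f) \<Rightarrow> 'u set \<Rightarrow> ('u \<Rightarrow> 'f) \<Rightarrow>
   'u \<Rightarrow> 'u \<Rightarrow> real" where
  "sim_dist \<Lambda> X \<xi> Y \<zeta> x y = Inf {\<epsilon>\<in>V. similar \<Lambda> \<epsilon> X \<xi> Y \<zeta> x y}"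

datatype 'l formula =
    Bot
  | Top
  | And "'l formula" "'l formula"
  | Or "'l formula" "'l formula"
  | Modal 'l real "'l formula"

inductive_set formulae :: "'l set \<Rightarrow> 'l formula set" for \<Lambda> :: "'l set" where
  "Bot \<in> formulae \<Lambda>"
| "Top \<in> formulae \<Lambda>"
| "\<phi> \<in> formulae \<Lambda> \<Longrightarrow> \<psi> \<in> formulae \<Lambda> \<Longrightarrow> And \<phi> \<psi> \<in> formulae \<Lambda>"
| "\<phi> \<in> formulae \<Lambda> \<Longrightarrow> \<psi> \<in> formulae \<Lambda> \<Longrightarrow> Or \<phi> \<psi> \<in> formulae \<Lambda>"
| "l \<in> \<Lambda> \<Longrightarrow> q \<in> V \<Longrightarrow> \<phi> \<in> formulae \<Lambda> \<Longrightarrow> Modal l q \<phi> \<in> formulae \<Lambda>"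

fun sat :: "'u set \<Rightarrow> ('u \<Rightarrow> 'f) \<Rightarrow> real \<Rightarrow> 'u \<Rightarrow> ('u, 'f) lifting formula \<Rightarrow> bool" where
  "sat X \<xi> \<epsilon> x Bot \<longleftrightarrow> False"
| "sat X \<xi> \<epsilon> x Top \<longleftrightarrow> True"
| "sat X \<xi> \<epsilon> x (And \<phi> \<psi>) \<longleftrightarrow> sat X \<xi> \<epsilon> x \<phi> \<and> sat X \<xi> \<epsilon> x \<psi>"
| "sat X \<xi> \<epsilon> x (Or \<phi> \<psi>) \<longleftrightarrow> sat X \<xi> \<epsilon> x \<phi> \<or> sat X \<xi> \<epsilon> x \<psi>"
| "sat X \<xi> \<epsilon> x (Modal l q \<phi>) \<longleftrightarrow> l X {z\<in>X. sat X \<xi> \<epsilon> z \<phi>} (\<xi> x) \<ge> q \<ominus> \<epsilon>"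

definition logically_included ::
  "('u, 'f) lifting set \<Rightarrow> real \<Rightarrow> 'u set \<Rightarrow> ('u \<Rightarrow> 'f) \<Rightarrow> 'u set \<Rightarrow> ('u \<Rightarrow> 'f) \<Rightarrow>
   'u \<Rightarrow> 'u \<Rightarrow> bool" where
  "logically_included \<Lambda> \<epsilon> X \<xi> Y \<zeta> x y \<longleftrightarrow>
     (\<forall>\<phi>\<in>formulae \<Lambda>. \<forall>\<delta>\<in>V. sat X \<xi> \<delta> x \<phi> \<longrightarrow> sat Y \<zeta> (\<delta> \<oplus> \<epsilon>) y \<phi>)"

end

theory Submission
  imports Defs
begin

text \<open>Left to right, satisfaction up to \<open>\<delta>\<close> is transported along an
  \<open>\<epsilon>\<close>-simulation to satisfaction up to \<open>\<delta> + \<epsilon>\<close>. The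
  infimum defining the distance need not be attained a priori; instead, finite branching makes
  falsity of a formula up to \<open>\<eta>\<close> persist for all slightly larger error bounds.
  Right to left, logical inclusion up to \<open>\<epsilon>\<close> is itself an
  \<open>\<epsilon>\<close>-simulation: finite branching reduces the simulation condition to finitely many
  pairs of unrelated states, and lowering all thresholds \<open>q\<close> in a distinguishing formula
  by its \<open>\<delta>\<close> brings these formulae to the common bound 0, where they can be
  combined into one.\<close>

section \<open>Values of liftings on finitely branching coalgebras\<close>

lemma lifting_range:
  assumes "monotone_predicate_lifting F Fm l" "coalgebra F X \<xi>" "x \<in> X" "A \<subseteq> X"
  shows "l X A (\<xi> x) \<in> V"
proof -
  have "\<xi> x \<in> F X"
    using assms(2,3) unfolding coalgebra_def by (rule Pi_mem)
  then show ?thesis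
    using assms(1,4) unfolding monotone_predicate_lifting_def by simp
qed

lemma lifting_mono:
  assumes "monotone_predicate_lifting F Fm l" "coalgebra F X \<xi>" "x \<in> X" "A \<subseteq> B" "B \<subseteq> X"
  shows "l X A (\<xi> x) \<le> l X B (\<xi> x)"
proof -
  have "\<xi> x \<in> F X"
    using assms(2,3) unfolding coalgebra_def by (rule Pi_mem)
  then show ?thesis
    using assms(1,4,5) unfolding monotone_predicate_lifting_def by simp
qed

lemma lifting_natural:
  assumes "monotone_predicate_lifting F Fm l" "f \<in> X \<rightarrow>\<^sub>E Y" "A \<subseteq> Y" "a \<in> F X"
  shows "l Y A (Fm X Y f a) = l X {x\<in>X. f x \<in> A} a"
  using assms unfolding monotone_predicate_lifting_def by simp

text \<open>By naturality along the inclusion of \<open>X0\<close>, the value of a lifting at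
  \<open>A\<close> equals its value on \<open>X0\<close> at the trace of \<open>A\<close>.
  Monotonicity on \<open>X0\<close> then compares traces only, so \<open>A\<close> may exceed
  \<open>B\<close> outside the finite set \<open>X0\<close>.\<close>

lemma finitely_branching_support:
  assumes "finitely_branching F Fm X \<xi>" "x \<in> X"
  obtains X0 where "X0 \<subseteq> X" "finite X0"
    "\<And>l A B. monotone_predicate_lifting F Fm l \<Longrightarrow> A \<subseteq> X \<Longrightarrow> B \<subseteq> X \<Longrightarrow> A \<inter> X0 \<subseteq> B \<Longrightarrow>
       l X A (\<xi> x) \<le> l X B (\<xi> x)"
proof -
  obtain X0 a where X0: "X0 \<subseteq> X" "finite X0" and a: "a \<in> F X0" "Fm X0 X (\<lambda>z\<in>X0. z) a = \<xi> x"
    using assms unfolding finitely_branching_def by blast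
  have incl: "(\<lambda>z\<in>X0. z) \<in> X0 \<rightarrow>\<^sub>E X"
    using X0 by auto
  have restrict: "l X A (\<xi> x) = l X0 {z\<in>X0. (\<lambda>z\<in>X0. z) z \<in> A} a"
    if "monotone_predicate_lifting F Fm l" "A \<subseteq> X" for l :: "('a, 'b) lifting" and A
    using lifting_natural[OF that(1) incl that(2) a(1)] by (simp only: a(2))
  have "l X A (\<xi> x) \<le> l X B (\<xi> x)"
    if l: "monotone_predicate_lifting F Fm l" and AB: "A \<subseteq> X" "B \<subseteq> X" "A \<inter> X0 \<subseteq> B"
    for l :: "('a, 'b) lifting" and A B
  proof -
    have "{z\<in>X0. (\<lambda>z\<in>X0. z) z \<in> A} \<subseteq> {z\<in>X0. (\<lambda>z\<in>X0. z) z \<in> B}"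
      using AB by auto
    moreover have "{z\<in>X0. (\<lambda>z\<in>X0. z) z \<in> B} \<subseteq> X0"
      by blast
    ultimately have "l X0 {z\<in>X0. (\<lambda>z\<in>X0. z) z \<in> A} a \<le> l X0 {z\<in>X0. (\<lambda>z\<in>X0. z) z \<in> B} a"
      using l a(1) unfolding monotone_predicate_lifting_def by blast
    then show ?thesis
      by (simp only: restrict[OF l AB(1)] restrict[OF l AB(2)])
  qed
  with X0 that show thesis by blast
qed

section \<open>Dependence of satisfaction on the error bound\<close>

lemma sat_min_one:
  assumes "\<phi> \<in> formulae \<Lambda>"
  shows "sat X \<xi> (min \<eta> 1) x \<phi> \<longleftrightarrow> sat X \<xi> \<eta> x \<phi>"
  using assms
proof (induction arbitrary: x rule: formulae.induct)
  case (5 l q \<phi>)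
  \<comment> \<open>Thresholds are at most 1, so every error bound from 1 on makes them 0. This is
    what lets the truncated sum be replaced by ordinary addition.\<close>
  then have "q \<ominus> min \<eta> 1 = q \<ominus> \<eta>"
    by (auto simp: tminus_def)
  with 5 show ?case by simp
qed auto

lemma sat_mono:
  assumes "\<phi> \<in> formulae \<Lambda>" "\<forall>l\<in>\<Lambda>. monotone_predicate_lifting F Fm l" "coalgebra F X \<xi>"
    and "x \<in> X" "\<eta> \<le> \<eta>'" "sat X \<xi> \<eta> x \<phi>"
  shows "sat X \<xi> \<eta>' x \<phi>"
  using assms(1,4,6)
proof (induction arbitrary: x rule: formulae.induct)
  case (5 l q \<phi>)
  have "q \<ominus> \<eta>' \<le> q \<ominus> \<eta>"
    using assms(5) by (auto simp: tminus_def)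
  also have "\<dots> \<le> l X {z\<in>X. sat X \<xi> \<eta> z \<phi>} (\<xi> x)"
    using 5 by simp
  also have "\<dots> \<le> l X {z\<in>X. sat X \<xi> \<eta>' z \<phi>} (\<xi> x)"
    using 5 assms by (intro lifting_mono[of F Fm]) auto
  finally show ?case by simp
qed auto

text \<open>A failing modal formula fails by a strict inequality, which leaves room on the right of
  \<open>\<eta>\<close>. The extension of the argument formula may grow with the bound, but each of
  the finitely many supporting states outside it stays outside on some right neighbourhood. On the
  intersection of these neighbourhoods the value of the lifting does not increase.\<close>

lemma eventually_not_sat_at_right:
  assumes "\<phi> \<in> formulae \<Lambda>" "\<forall>l\<in>\<Lambda>. monotone_predicate_lifting F Fm l" "coalgebra F X \<xi>"
    and "finitely_branching F Fm X \<xi>" "x \<in> X" "\<not> sat X \<xi> \<eta> x \<phi>"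
  shows "\<forall>\<^sub>F e in at_right \<eta>. \<not> sat X \<xi> e x \<phi>"
  using assms(1,5,6)
proof (induction arbitrary: x rule: formulae.induct)
  case (3 \<phi> \<psi>)
  then consider "\<not> sat X \<xi> \<eta> x \<phi>" | "\<not> sat X \<xi> \<eta> x \<psi>" by auto
  then show ?case
  proof cases
    case 1
    from "3.IH"(1)[OF "3.prems"(1) 1] show ?thesis by eventually_elim simp
  next
    case 2
    from "3.IH"(2)[OF "3.prems"(1) 2] show ?thesis by eventually_elim simp
  qed
next
  case (4 \<phi> \<psi>)
  then have "\<forall>\<^sub>F e in at_right \<eta>. \<not> sat X \<xi> e x \<phi>" "\<forall>\<^sub>F e in at_right \<eta>. \<not> sat X \<xi> e x \<psi>"
    by auto
  then show ?case by eventually_elim simp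
next
  case (5 l q \<phi>)
  define S where "S e = {z\<in>X. sat X \<xi> e z \<phi>}" for e
  have l: "monotone_predicate_lifting F Fm l"
    using 5 assms by blast
  obtain X0 where X0: "X0 \<subseteq> X" "finite X0"
    and supp: "\<And>l A B. monotone_predicate_lifting F Fm l \<Longrightarrow> A \<subseteq> X \<Longrightarrow> B \<subseteq> X \<Longrightarrow> A \<inter> X0 \<subseteq> B \<Longrightarrow>
       l X A (\<xi> x) \<le> l X B (\<xi> x)"
    using finitely_branching_support[OF assms(4) "5.prems"(1)] by blast
  have "l X (S \<eta>) (\<xi> x) \<in> V"
    using 5 assms by (intro lifting_range[OF l]) (auto simp: S_def)
  \<comment> \<open>The value is nonnegative and lies below a maximum with 0, so that maximum must
    be \<open>q - \<eta>\<close>.\<close>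
  with 5 have "\<eta> < q - l X (S \<eta>) (\<xi> x)"
    by (auto simp: S_def tminus_def)
  then have "\<forall>\<^sub>F e in at_right \<eta>. e < q - l X (S \<eta>) (\<xi> x)"
    by (rule eventually_at_rightI[rotated]) auto
  moreover have "\<forall>\<^sub>F e in at_right \<eta>. \<forall>z\<in>X0. z \<in> S e \<longrightarrow> z \<in> S \<eta>"
  proof (intro eventually_ball_finite X0 ballI)
    fix z assume "z \<in> X0"
    show "\<forall>\<^sub>F e in at_right \<eta>. z \<in> S e \<longrightarrow> z \<in> S \<eta>"
    proof (cases "z \<in> S \<eta>")
      case False
      with \<open>z \<in> X0\<close> X0 "5.IH"[of z] have "\<forall>\<^sub>F e in at_right \<eta>. \<not> sat X \<xi> e z \<phi>"
        by (auto simp: S_def)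
      then show ?thesis by eventually_elim (simp add: S_def)
    qed simp
  qed
  ultimately show ?case
  proof eventually_elim
    case (elim e)
    then have "l X (S e) (\<xi> x) \<le> l X (S \<eta>) (\<xi> x)"
      by (intro supp[OF l]) (auto simp: S_def)
    with elim show ?case
      by (auto simp: S_def tminus_def)
  qed
qed auto

section \<open>From simulations to logical inclusion\<close>

lemma simulationI:
  assumes "R \<subseteq> X \<times> Y"
    and "\<And>x y l A. (x, y) \<in> R \<Longrightarrow> l \<in> \<Lambda> \<Longrightarrow> A \<subseteq> X \<Longrightarrow> l X A (\<xi> x) - \<epsilon> \<le> l Y (R `` A) (\<zeta> y)"
  shows "simulation \<Lambda> \<epsilon> X \<xi> Y \<zeta> R"
  unfolding simulation_def by (intro conjI ballI allI impI case_prodI2 assms) auto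

lemma simulationD:
  assumes "simulation \<Lambda> \<epsilon> X \<xi> Y \<zeta> R" "(x, y) \<in> R" "l \<in> \<Lambda>" "A \<subseteq> X"
  shows "l X A (\<xi> x) - \<epsilon> \<le> l Y (R `` A) (\<zeta> y)"
proof -
  have "\<forall>l\<in>\<Lambda>. \<forall>A. A \<subseteq> X \<longrightarrow> l X A (\<xi> x) - \<epsilon> \<le> l Y (R `` A) (\<zeta> y)"
    using assms(1,2) unfolding simulation_def by auto
  with assms(3,4) show ?thesis by simp
qed

lemma simulation_sat:
  assumes "\<phi> \<in> formulae \<Lambda>" "\<forall>l\<in>\<Lambda>. monotone_predicate_lifting F Fm l" "coalgebra F Y \<zeta>"
    and "simulation \<Lambda> \<epsilon> X \<xi> Y \<zeta> R" "0 \<le> \<epsilon>" "(x, y) \<in> R" "sat X \<xi> \<delta> x \<phi>"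
  shows "sat Y \<zeta> (\<delta> + \<epsilon>) y \<phi>"
  using assms(1,6,7)
proof (induction arbitrary: x y rule: formulae.induct)
  case (5 l q \<phi>)
  define A where "A = {z\<in>X. sat X \<xi> \<delta> z \<phi>}"
  define B where "B = {z\<in>Y. sat Y \<zeta> (\<delta> + \<epsilon>) z \<phi>}"
  have l: "monotone_predicate_lifting F Fm l"
    using 5 assms by blast
  have R: "R \<subseteq> X \<times> Y"
    using assms by (simp add: simulation_def)
  with 5 have y: "y \<in> Y" by auto
  have "(q \<ominus> \<delta>) - \<epsilon> \<le> l X A (\<xi> x) - \<epsilon>"
    using 5 by (simp add: A_def)
  also have "\<dots> \<le> l Y (R `` A) (\<zeta> y)"
    by (rule simulationD[OF assms(4) "5.prems"(1) "5.hyps"(1)]) (auto simp: A_def)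
  \<comment> \<open>The induction hypothesis says that \<open>R\<close> maps the extension
    \<open>A\<close> into \<open>B\<close>.\<close>
  also have "\<dots> \<le> l Y B (\<zeta> y)"
    using "5.IH" R by (intro lifting_mono[OF l assms(3) y]) (auto simp: A_def B_def)
  finally have "(q \<ominus> \<delta>) - \<epsilon> \<le> l Y B (\<zeta> y)" .
  \<comment> \<open>Nonnegativity supplies the truncation at 0 in
    \<open>q \<ominus> (\<delta> + \<epsilon>)\<close>.\<close>
  moreover have "l Y B (\<zeta> y) \<in> V"
    by (intro lifting_range[OF l assms(3) y]) (auto simp: B_def)
  ultimately show ?case
    by (auto simp: B_def tminus_def)
qed auto

lemma similar_one:
  assumes "\<forall>l\<in>\<Lambda>. monotone_predicate_lifting F Fm l" "coalgebra F X \<xi>" "coalgebra F Y \<zeta>"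
    and "x \<in> X" "y \<in> Y"
  shows "similar \<Lambda> 1 X \<xi> Y \<zeta> x y"
proof -
  have "l X A (\<xi> u) - 1 \<le> l Y ((X \<times> Y) `` A) (\<zeta> v)"
    if "u \<in> X" "v \<in> Y" "l \<in> \<Lambda>" "A \<subseteq> X" for l u v A
    using lifting_range[of F Fm l X \<xi> u A] lifting_range[of F Fm l Y \<zeta> v "(X \<times> Y) `` A"] that assms
    by fastforce
  then have "simulation \<Lambda> 1 X \<xi> Y \<zeta> (X \<times> Y)"
    by (intro simulationI) auto
  with assms show ?thesis
    unfolding similar_def by blast
qed

lemma sim_dist_le_imp_logically_included:
  assumes "\<forall>l\<in>\<Lambda>. monotone_predicate_lifting F Fm l"
    and "coalgebra F X \<xi>" "coalgebra F Y \<zeta>" "finitely_branching F Fm Y \<zeta>"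
    and "x \<in> X" "y \<in> Y" "sim_dist \<Lambda> X \<xi> Y \<zeta> x y \<le> \<epsilon>"
  shows "logically_included \<Lambda> \<epsilon> X \<xi> Y \<zeta> x y"
  unfolding logically_included_def
proof (intro ballI impI, rule ccontr)
  fix \<phi> \<delta>
  assume \<phi>: "\<phi> \<in> formulae \<Lambda>" and sat: "sat X \<xi> \<delta> x \<phi>" and "\<not> sat Y \<zeta> (\<delta> \<oplus> \<epsilon>) y \<phi>"
  then have "\<not> sat Y \<zeta> (\<delta> + \<epsilon>) y \<phi>"
    by (simp add: tplus_def sat_min_one)
  \<comment> \<open>A bound \<open>e\<close> strictly above \<open>\<delta> + \<epsilon>\<close>
    leaves \<open>e - \<delta>\<close> strictly above the distance. Some simulation then has error
    below \<open>e - \<delta>\<close>, and transporting \<open>\<phi>\<close> along it contradicts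
    its falsity up to \<open>e\<close>.\<close>
  then have "\<forall>\<^sub>F e in at_right (\<delta> + \<epsilon>). \<not> sat Y \<zeta> e y \<phi> \<and> \<delta> + \<epsilon> < e"
    using eventually_not_sat_at_right[OF \<phi> assms(1,3,4,6)]
    by (auto intro: eventually_conj eventually_at_right_less)
  then obtain e where e: "\<not> sat Y \<zeta> e y \<phi>" "\<delta> + \<epsilon> < e"
    using eventually_happens' trivial_limit_at_right_real by blast
  have "Inf {\<epsilon>\<in>V. similar \<Lambda> \<epsilon> X \<xi> Y \<zeta> x y} < e - \<delta>"
    using assms(7) e by (simp add: sim_dist_def)
  \<comment> \<open>Nonemptiness is required before an element close to the real infimum can be
    chosen.\<close>
  moreover have "1 \<in> {\<epsilon>\<in>V. similar \<Lambda> \<epsilon> X \<xi> Y \<zeta> x y}"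
    using similar_one[OF assms(1-3,5,6)] by simp
  ultimately have "\<exists>\<epsilon>'\<in>{\<epsilon>\<in>V. similar \<Lambda> \<epsilon> X \<xi> Y \<zeta> x y}. \<epsilon>' < e - \<delta>"
    by (intro cInf_lessD) auto
  then obtain \<epsilon>' where "\<epsilon>' \<in> V" "similar \<Lambda> \<epsilon>' X \<xi> Y \<zeta> x y" and less: "\<epsilon>' < e - \<delta>"
    by blast
  then have sat': "sat Y \<zeta> (\<delta> + \<epsilon>') y \<phi>"
    using simulation_sat[OF \<phi> assms(1,3)] sat by (auto simp: similar_def)
  have "sat Y \<zeta> e y \<phi>"
    by (rule sat_mono[OF \<phi> assms(1,3,6) _ sat']) (use less in simp)
  with e show False by blast
qed

section \<open>From logical inclusion to simulations\<close>

primrec lower :: "real \<Rightarrow> 'l formula \<Rightarrow> 'l formula" where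
  "lower d Bot = Bot"
| "lower d Top = Top"
| "lower d (And \<phi> \<psi>) = And (lower d \<phi>) (lower d \<psi>)"
| "lower d (Or \<phi> \<psi>) = Or (lower d \<phi>) (lower d \<psi>)"
| "lower d (Modal l q \<phi>) = Modal l (q \<ominus> d) (lower d \<phi>)"

lemma lower_in_formulae:
  assumes "\<phi> \<in> formulae \<Lambda>" "0 \<le> d"
  shows "lower d \<phi> \<in> formulae \<Lambda>"
  using assms by induction (auto intro!: formulae.intros simp: tminus_def)

text \<open>An error allowance can be moved from the semantics into the thresholds. Truncating after
  subtracting \<open>d\<close> is harmless, because subtracting the nonnegative \<open>e\<close> and
  truncating again gives the same result.\<close>

lemma sat_lower:
  assumes "0 \<le> e"
  shows "sat X \<xi> e x (lower d \<phi>) \<longleftrightarrow> sat X \<xi> (d + e) x \<phi>"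
proof (induction \<phi> arbitrary: x)
  case (Modal l q \<phi>)
  have "(q \<ominus> d) \<ominus> e = q \<ominus> (d + e)"
    using assms by (auto simp: tminus_def)
  with Modal show ?case by simp
qed auto

lemma not_logically_includedE:
  assumes "\<not> logically_included \<Lambda> \<epsilon> X \<xi> Y \<zeta> x y" "0 \<le> \<epsilon>"
  obtains \<phi> where "\<phi> \<in> formulae \<Lambda>" "sat X \<xi> 0 x \<phi>" "\<not> sat Y \<zeta> \<epsilon> y \<phi>"
proof -
  obtain \<phi> \<delta> where "\<phi> \<in> formulae \<Lambda>" "\<delta> \<in> V" "sat X \<xi> \<delta> x \<phi>" "\<not> sat Y \<zeta> (\<delta> \<oplus> \<epsilon>) y \<phi>"
    using assms unfolding logically_included_def by blast
  then show thesis
    using assms(2)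
    \<comment> \<open>Lowering by the witness's own \<open>\<delta>\<close> turns the bounds
      \<open>\<delta>\<close> and \<open>\<delta> + \<epsilon>\<close> into 0 and
      \<open>\<epsilon>\<close>.\<close>
    by (intro that[of "lower \<delta> \<phi>"]) (auto simp: sat_lower tplus_def sat_min_one intro: lower_in_formulae)
qed

text \<open>The equivalence is uniform in coalgebra and bound, since the same formula is later
  evaluated in \<open>X\<close> up to 0 and in \<open>Y\<close> up to
  \<open>\<epsilon>\<close>.\<close>

lemma finite_conjunction:
  assumes "finite I" "\<forall>i\<in>I. \<phi> i \<in> formulae \<Lambda>"
  shows "\<exists>\<psi>\<in>formulae \<Lambda>. \<forall>X \<xi> e x. sat X \<xi> e x \<psi> \<longleftrightarrow> (\<forall>i\<in>I. sat X \<xi> e x (\<phi> i))"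
  using assms
proof (induction I)
  case empty
  show ?case by (intro bexI[of _ Top]) (auto intro: formulae.intros)
next
  case (insert i I)
  then obtain \<psi> where "\<psi> \<in> formulae \<Lambda>"
    "\<forall>X \<xi> e x. sat X \<xi> e x \<psi> \<longleftrightarrow> (\<forall>i\<in>I. sat X \<xi> e x (\<phi> i))"
    by auto
  with insert show ?case
    by (intro bexI[of _ "And (\<phi> i) \<psi>"]) (auto intro: formulae.intros)
qed

lemma finite_disjunction:
  assumes "finite I" "\<forall>i\<in>I. \<phi> i \<in> formulae \<Lambda>"
  shows "\<exists>\<psi>\<in>formulae \<Lambda>. \<forall>X \<xi> e x. sat X \<xi> e x \<psi> \<longleftrightarrow> (\<exists>i\<in>I. sat X \<xi> e x (\<phi> i))"
  using assms
proof (induction I)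
  case empty
  show ?case by (intro bexI[of _ Bot]) (auto intro: formulae.intros)
next
  case (insert i I)
  then obtain \<psi> where "\<psi> \<in> formulae \<Lambda>"
    "\<forall>X \<xi> e x. sat X \<xi> e x \<psi> \<longleftrightarrow> (\<exists>i\<in>I. sat X \<xi> e x (\<phi> i))"
    by auto
  with insert show ?case
    by (intro bexI[of _ "Or (\<phi> i) \<psi>"]) (auto intro: formulae.intros)
qed

text \<open>The formula is a disjunction over \<open>A\<close> of conjunctions over \<open>B\<close>
  of distinguishing formulae. Each \<open>a\<close> satisfies its own disjunct, while each
  \<open>b\<close> violates a conjunct of every disjunct.\<close>

lemma separating_formula:
  assumes "finite A" "finite B" "0 \<le> \<epsilon>"
    and "\<forall>a\<in>A. \<forall>b\<in>B. \<not> logically_included \<Lambda> \<epsilon> X \<xi> Y \<zeta> a b"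
  obtains \<psi> where "\<psi> \<in> formulae \<Lambda>" "\<forall>a\<in>A. sat X \<xi> 0 a \<psi>" "\<forall>b\<in>B. \<not> sat Y \<zeta> \<epsilon> b \<psi>"
proof -
  have "\<forall>a\<in>A. \<forall>b\<in>B. \<exists>\<phi>\<in>formulae \<Lambda>. sat X \<xi> 0 a \<phi> \<and> \<not> sat Y \<zeta> \<epsilon> b \<phi>"
    using assms(3,4) by (blast elim: not_logically_includedE)
  then obtain \<phi> where \<phi>: "\<forall>a\<in>A. \<forall>b\<in>B. \<phi> a b \<in> formulae \<Lambda> \<and> sat X \<xi> 0 a (\<phi> a b) \<and> \<not> sat Y \<zeta> \<epsilon> b (\<phi> a b)"
    by metis
  have "\<forall>a\<in>A. \<exists>\<chi>\<in>formulae \<Lambda>. sat X \<xi> 0 a \<chi> \<and> (\<forall>b\<in>B. \<not> sat Y \<zeta> \<epsilon> b \<chi>)"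
  proof
    fix a assume "a \<in> A"
    with \<phi> show "\<exists>\<chi>\<in>formulae \<Lambda>. sat X \<xi> 0 a \<chi> \<and> (\<forall>b\<in>B. \<not> sat Y \<zeta> \<epsilon> b \<chi>)"
      using finite_conjunction[OF assms(2), of "\<phi> a" \<Lambda>] by blast
  qed
  then obtain \<chi> where \<chi>: "\<forall>a\<in>A. \<chi> a \<in> formulae \<Lambda> \<and> sat X \<xi> 0 a (\<chi> a) \<and> (\<forall>b\<in>B. \<not> sat Y \<zeta> \<epsilon> b (\<chi> a))"
    by metis
  then obtain \<psi> where "\<psi> \<in> formulae \<Lambda>"
    "\<forall>X \<xi> e x. sat X \<xi> e x \<psi> \<longleftrightarrow> (\<exists>a\<in>A. sat X \<xi> e x (\<chi> a))"
    using finite_disjunction[OF assms(1), of \<chi> \<Lambda>] by blast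
  with \<chi> that show thesis by blast
qed

lemma simulation_logically_included:
  assumes mpl: "\<forall>l\<in>\<Lambda>. monotone_predicate_lifting F Fm l"
    and X: "coalgebra F X \<xi>" "finitely_branching F Fm X \<xi>"
    and Y: "finitely_branching F Fm Y \<zeta>" and "0 \<le> \<epsilon>" "\<epsilon> \<le> 1"
  shows "simulation \<Lambda> \<epsilon> X \<xi> Y \<zeta> {(x, y). x \<in> X \<and> y \<in> Y \<and> logically_included \<Lambda> \<epsilon> X \<xi> Y \<zeta> x y}"
    (is "simulation _ _ _ _ _ _ ?R")
proof -
  have "l X A (\<xi> x) - \<epsilon> \<le> l Y (?R `` A) (\<zeta> y)"
    if x: "x \<in> X" and y: "y \<in> Y" and incl: "logically_included \<Lambda> \<epsilon> X \<xi> Y \<zeta> x y"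
      and l\<Lambda>: "l \<in> \<Lambda>" and A: "A \<subseteq> X" for x y l A
  proof -
    have l: "monotone_predicate_lifting F Fm l"
      using mpl l\<Lambda> by blast
    obtain X0 where X0: "X0 \<subseteq> X" "finite X0"
      and suppX: "\<And>l A B. monotone_predicate_lifting F Fm l \<Longrightarrow> A \<subseteq> X \<Longrightarrow> B \<subseteq> X \<Longrightarrow>
        A \<inter> X0 \<subseteq> B \<Longrightarrow> l X A (\<xi> x) \<le> l X B (\<xi> x)"
      using finitely_branching_support[OF X(2) x] by blast
    obtain Y0 where Y0: "Y0 \<subseteq> Y" "finite Y0"
      and suppY: "\<And>l A B. monotone_predicate_lifting F Fm l \<Longrightarrow> A \<subseteq> Y \<Longrightarrow> B \<subseteq> Y \<Longrightarrow>
        A \<inter> Y0 \<subseteq> B \<Longrightarrow> l Y A (\<zeta> y) \<le> l Y B (\<zeta> y)"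
      using finitely_branching_support[OF Y y] by blast
    \<comment> \<open>A state of \<open>Y0\<close> outside the image of \<open>A\<close> is related
      to no element of \<open>A\<close>, so distinguishing formulae exist for all the pairs in
      question.\<close>
    obtain \<psi> where \<psi>: "\<psi> \<in> formulae \<Lambda>" "\<forall>a\<in>A \<inter> X0. sat X \<xi> 0 a \<psi>"
      "\<forall>b\<in>Y0 - ?R `` A. \<not> sat Y \<zeta> \<epsilon> b \<psi>"
    proof (rule separating_formula[of "A \<inter> X0" "Y0 - ?R `` A"])
      show "\<forall>a\<in>A \<inter> X0. \<forall>b\<in>Y0 - ?R `` A. \<not> logically_included \<Lambda> \<epsilon> X \<xi> Y \<zeta> a b"
        using A Y0 by auto
    qed (use X0 Y0 \<open>0 \<le> \<epsilon>\<close> in auto)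
    \<comment> \<open>The exact value at \<open>x\<close> is the largest threshold that
      \<open>x\<close> meets up to 0, so no precision is lost when passing to
      \<open>y\<close>.\<close>
    define q where "q = l X A (\<xi> x)"
    have q: "q \<in> V"
      unfolding q_def by (rule lifting_range[OF l X(1) x A])
    have "q \<le> l X {z\<in>X. sat X \<xi> 0 z \<psi>} (\<xi> x)"
      unfolding q_def using A \<psi> by (intro suppX[OF l]) auto
    with q have "sat X \<xi> 0 x (Modal l q \<psi>)"
      by (simp add: tminus_def)
    moreover have "Modal l q \<psi> \<in> formulae \<Lambda>"
      using l\<Lambda> q \<psi> by (intro formulae.intros)
    ultimately have "sat Y \<zeta> (0 \<oplus> \<epsilon>) y (Modal l q \<psi>)"
      using incl[unfolded logically_included_def, rule_format, of "Modal l q \<psi>" 0] by simp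
    then have "q - \<epsilon> \<le> l Y {z\<in>Y. sat Y \<zeta> \<epsilon> z \<psi>} (\<zeta> y)"
      using \<open>\<epsilon> \<le> 1\<close> by (simp add: tminus_def tplus_def)
    \<comment> \<open>Within \<open>Y0\<close>, the extension of \<open>\<psi>\<close> up to
      \<open>\<epsilon>\<close> lies in the image of \<open>A\<close>, which suffices by the support
      property.\<close>
    also have "\<dots> \<le> l Y (?R `` A) (\<zeta> y)"
      using \<psi>(3) by (intro suppY[OF l]) blast+
    finally show ?thesis
      by (simp add: q_def)
  qed
  then show ?thesis
    by (intro simulationI) auto
qed

theorem theorem5p8:
  fixes F :: "'u set \<Rightarrow> 'f set"
    and Fm :: "'u set \<Rightarrow> 'u set \<Rightarrow> ('u \<Rightarrow> 'u) \<Rightarrow> 'f \<Rightarrow> 'f"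
    and \<Lambda> :: "('u, 'f) lifting set"
    and X Y :: "'u set" and \<xi> \<zeta> :: "'u \<Rightarrow> 'f"
    and x y :: 'u and \<epsilon> :: real
  assumes "set_functor F Fm"
    and "\<forall>l\<in>\<Lambda>. monotone_predicate_lifting F Fm l"
    and "coalgebra F X \<xi>" and "finitely_branching F Fm X \<xi>"
    and "coalgebra F Y \<zeta>" and "finitely_branching F Fm Y \<zeta>"
    and "x \<in> X" and "y \<in> Y" and "\<epsilon> \<in> V"
  shows "sim_dist \<Lambda> X \<xi> Y \<zeta> x y \<le> \<epsilon> \<longleftrightarrow> logically_included \<Lambda> \<epsilon> X \<xi> Y \<zeta> x y"
proof
  assume "sim_dist \<Lambda> X \<xi> Y \<zeta> x y \<le> \<epsilon>"
  then show "logically_included \<Lambda> \<epsilon> X \<xi> Y \<zeta> x y"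
    by (rule sim_dist_le_imp_logically_included[OF assms(2,3,5,6,7,8)])
next
  assume "logically_included \<Lambda> \<epsilon> X \<xi> Y \<zeta> x y"
  \<comment> \<open>The simulation has error exactly \<open>\<epsilon>\<close>, so
    \<open>\<epsilon>\<close> belongs to the set whose infimum is taken and no limit argument
    arises.\<close>
  then have "similar \<Lambda> \<epsilon> X \<xi> Y \<zeta> x y"
    unfolding similar_def using assms(7-9)
    by (intro exI[of _ "{(x, y). x \<in> X \<and> y \<in> Y \<and> logically_included \<Lambda> \<epsilon> X \<xi> Y \<zeta> x y}"]
        conjI simulation_logically_included[OF assms(2,3,4,6)]) auto
  moreover have "bdd_below {\<epsilon>\<in>V. similar \<Lambda> \<epsilon> X \<xi> Y \<zeta> x y}"
    by (rule bdd_belowI[of _ 0]) auto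
  ultimately show "sim_dist \<Lambda> X \<xi> Y \<zeta> x y \<le> \<epsilon>"
    unfolding sim_dist_def using assms(9) by (intro cInf_lower) auto
qed

end
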